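(* Let $p$ be a prime, let $G$ and $H$ be finite groups, and let $S$ and $R$ be Sylow $p$-subgroups of $G$ and $H$, respectively. Then $G\simeq_p H$ (that is, $G$ and $H$ are $p$-locally equivalent) if and only if there exists an isomorphism of fusion systems $\mathcal{F}_S(G)\to\mathcal{F}_R(H)$.
   Context: Let $G$ be a finite group and $P,Q\le G$. A homomorphism $f\colon P\to Q$ is a $G$-subconjugation if there is $g\in G$ with $f(x)=gxg^{-1}$ for all $x\in P$; write $\mathrm{Hom}_G(P,Q)$ for the set of $G$-subconjugations $P\to Q$. Finite groups $G$ and $H$ are $p$-locally equivalent, written $G\simeq_p H$, if there is a group isomorphism $\alpha\colon S'\to R'$ between some Sylow $p$-subgroup $S'$ of $G$ and some Sylow $p$-subgroup $R'$ of $H$ such that for all subgroups $P,Q\le S'$ and every homomorphism $f\colon P\to Q$: $f$ is a $G$-subconjugation if and only if $\alpha f\alpha^{-1}\colon\alpha(P)\to\alpha(Q)$ is an $H$-subconjugation. For a Sylow $p$-subgroup $S$ of $G$, the fusion system $\mathcal{F}_S(G)$ is the category whose objects are the subgroups of $S$ and whose morphisms are $\mathrm{Mor}_{\mathcal{F}_S(G)}(P,Q)=\mathrm{Hom}_G(P,Q)$, with composition of maps. An isomorphism of fusion systems $\mathcal{F}_S(G)\to\mathcal{F}_R(H)$ is an isomorphism of categories of the form $\alpha_*$ for some group isomorphism $\alpha\colon S\to R$, where $\alpha_*(P)=\alpha(P)$ on objects and $\alpha_*(f)=\alpha f\alpha^{-1}$ on morphisms (in particular $\alpha_*$ must be well defined,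 i.e. send $G$-subconjugations to $H$-subconjugations). *)

theory Defs
  imports "HOL-Algebra.Sylow"
begin

section \<open>Categories with set-valued object and morphism collections\<close>

record ('o, 'm) cat =
  Obj :: "'o set"
  Mor :: "'o \<Rightarrow> 'o \<Rightarrow> 'm set"
  Ident :: "'o \<Rightarrow> 'm"
  Comp :: "'o \<Rightarrow> 'o \<Rightarrow> 'o \<Rightarrow> 'm \<Rightarrow> 'm \<Rightarrow> 'm"

text \<open>\<open>Comp C X Y Z g f\<close> is the composite of \<open>f : X \<rightarrow> Y\<close> followed by \<open>g : Y \<rightarrow> Z\<close>.\<close>

definition is_category :: "('o, 'm) cat \<Rightarrow> bool" where
  "is_category C \<longleftrightarrow>
    (\<forall>X \<in> Obj C. Ident C X \<in> Mor C X X) \<and>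
    (\<forall>X \<in> Obj C. \<forall>Y \<in> Obj C. \<forall>Z \<in> Obj C. \<forall>f \<in> Mor C X Y. \<forall>g \<in> Mor C Y Z.
       Comp C X Y Z g f \<in> Mor C X Z) \<and>
    (\<forall>X \<in> Obj C. \<forall>Y \<in> Obj C. \<forall>f \<in> Mor C X Y.
       Comp C X X Y f (Ident C X) = f \<and> Comp C X Y Y (Ident C Y) f = f) \<and>
    (\<forall>W \<in> Obj C. \<forall>X \<in> Obj C. \<forall>Y \<in> Obj C. \<forall>Z \<in> Obj C.
       \<forall>f \<in> Mor C W X. \<forall>g \<in> Mor C X Y. \<forall>h \<in> Mor C Y Z.
       Comp C W Y Z h (Comp C W X Y g f) = Comp C W X Z (Comp C X Y Z h g) f)"

definition is_functor ::
  "('o, 'm) cat \<Rightarrow> ('o2, 'm2) cat \<Rightarrow> ('o \<Rightarrow> 'o2) \<Rightarrow> ('o \<Rightarrow> 'o \<Rightarrow> 'm \<Rightarrow> 'm2) \<Rightarrow> bool" where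
  "is_functor C D F \<phi> \<longleftrightarrow>
    (\<forall>X \<in> Obj C. F X \<in> Obj D) \<and>
    (\<forall>X \<in> Obj C. \<forall>Y \<in> Obj C. \<forall>f \<in> Mor C X Y. \<phi> X Y f \<in> Mor D (F X) (F Y)) \<and>
    (\<forall>X \<in> Obj C. \<phi> X X (Ident C X) = Ident D (F X)) \<and>
    (\<forall>X \<in> Obj C. \<forall>Y \<in> Obj C. \<forall>Z \<in> Obj C. \<forall>f \<in> Mor C X Y. \<forall>g \<in> Mor C Y Z.
       \<phi> X Z (Comp C X Y Z g f) = Comp D (F X) (F Y) (F Z) (\<phi> Y Z g) (\<phi> X Y f))"

definition is_cat_iso ::
  "('o, 'm) cat \<Rightarrow> ('o2, 'm2) cat \<Rightarrow> ('o \<Rightarrow> 'o2) \<Rightarrow> ('o \<Rightarrow> 'o \<Rightarrow> 'm \<Rightarrow> 'm2) \<Rightarrow> bool" where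
  "is_cat_iso C D F \<phi> \<longleftrightarrow> is_functor C D F \<phi> \<and>
    (\<exists>K \<psi>. is_functor D C K \<psi> \<and>
      (\<forall>X \<in> Obj C. K (F X) = X) \<and>
      (\<forall>Y \<in> Obj D. F (K Y) = Y) \<and>
      (\<forall>X \<in> Obj C. \<forall>Y \<in> Obj C. \<forall>f \<in> Mor C X Y. \<psi> (F X) (F Y) (\<phi> X Y f) = f) \<and>
      (\<forall>X \<in> Obj D. \<forall>Y \<in> Obj D. \<forall>f \<in> Mor D X Y. \<phi> (K X) (K Y) (\<psi> X Y f) = f))"


section \<open>Sylow subgroups, subconjugations, local equivalence\<close>

definition sylow_subgroup :: "nat \<Rightarrow> ('a, 'm) monoid_scheme \<Rightarrow> 'a set \<Rightarrow> bool" where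
  "sylow_subgroup p G S \<longleftrightarrow> subgroup S G \<and> card S = p ^ multiplicity p (order G)"

text \<open>A map with domain \<open>P\<close> is represented by its extension by \<open>undefined\<close> outside \<open>P\<close>,
  so that equality of morphisms is equality of maps on \<open>P\<close>.\<close>

definition subgroup_homs :: "('a, 'm) monoid_scheme \<Rightarrow> 'a set \<Rightarrow> 'a set \<Rightarrow> ('a \<Rightarrow> 'a) set" where
  "subgroup_homs G P Q = hom (G\<lparr>carrier := P\<rparr>) (G\<lparr>carrier := Q\<rparr>) \<inter> extensional P"

definition subconjugations :: "('a, 'm) monoid_scheme \<Rightarrow> 'a set \<Rightarrow> 'a set \<Rightarrow> ('a \<Rightarrow> 'a) set" where
  "subconjugations G P Q = {f \<in> subgroup_homs G P Q.
     \<exists>g \<in> carrier G. \<forall>x \<in> P. f x = g \<otimes>\<^bsub>G\<^esub> x \<otimes>\<^bsub>G\<^esub> inv\<^bsub>G\<^esub> g}"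

text \<open>For \<open>f\<close> defined on \<open>P\<close> and \<open>\<alpha>\<close> injective on \<open>P\<close>, this is
  \<open>\<alpha> \<circ> f \<circ> \<alpha>\<^sup>-\<^sup>1\<close> on \<open>\<alpha>(P)\<close>.\<close>

definition transport_map :: "('a \<Rightarrow> 'b) \<Rightarrow> 'a set \<Rightarrow> ('a \<Rightarrow> 'a) \<Rightarrow> 'b \<Rightarrow> 'b" where
  "transport_map \<alpha> P f = (\<lambda>y \<in> \<alpha> ` P. \<alpha> (f (inv_into P \<alpha> y)))"

definition p_locally_equivalent ::
  "nat \<Rightarrow> ('a, 'm) monoid_scheme \<Rightarrow> ('b, 'n) monoid_scheme \<Rightarrow> bool" where
  "p_locally_equivalent p G H \<longleftrightarrow>
    (\<exists>S' R' \<alpha>. sylow_subgroup p G S' \<and> sylow_subgroup p H R' \<and>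
       \<alpha> \<in> iso (G\<lparr>carrier := S'\<rparr>) (H\<lparr>carrier := R'\<rparr>) \<and>
       (\<forall>P Q. subgroup P G \<and> P \<subseteq> S' \<and> subgroup Q G \<and> Q \<subseteq> S' \<longrightarrow>
          (\<forall>f \<in> subgroup_homs G P Q.
             f \<in> subconjugations G P Q \<longleftrightarrow>
             transport_map \<alpha> P f \<in> subconjugations H (\<alpha> ` P) (\<alpha> ` Q))))"


section \<open>Fusion systems\<close>

definition fusion_system :: "('a, 'm) monoid_scheme \<Rightarrow> 'a set \<Rightarrow> ('a set, 'a \<Rightarrow> 'a) cat" where
  "fusion_system G S =
    \<lparr>Obj = {P. subgroup P G \<and> P \<subseteq> S},
     Mor = subconjugations G,
     Ident = (\<lambda>P. \<lambda>x \<in> P. x),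
     Comp = (\<lambda>P Q R g f. compose P g f)\<rparr>"

definition fusion_system_iso ::
  "('a, 'm) monoid_scheme \<Rightarrow> 'a set \<Rightarrow> ('b, 'n) monoid_scheme \<Rightarrow> 'b set \<Rightarrow> ('a \<Rightarrow> 'b) \<Rightarrow> bool" where
  "fusion_system_iso G S H R \<alpha> \<longleftrightarrow>
    \<alpha> \<in> iso (G\<lparr>carrier := S\<rparr>) (H\<lparr>carrier := R\<rparr>) \<and>
    is_cat_iso (fusion_system G S) (fusion_system H R)
      (\<lambda>P. \<alpha> ` P) (\<lambda>P Q f. transport_map \<alpha> P f)"

lemma (in group) is_category_fusion_system: "is_category (fusion_system G S)"
proof -
  have ident: "(\<lambda>x\<in>P. x) \<in> subconjugations G P P" if P: "subgroup P G" for P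
  proof -
    have "(\<lambda>x\<in>P. x) x = \<one> \<otimes> x \<otimes> inv \<one>" if "x \<in> P" for x
      using that subgroup.mem_carrier[OF P] by simp
    moreover have "(\<lambda>x\<in>P. x) \<in> subgroup_homs G P P"
      using subgroup.m_closed[OF P] by (auto simp: subgroup_homs_def hom_def)
    ultimately show ?thesis
      unfolding subconjugations_def by blast
  qed
  have comp: "compose P g f \<in> subconjugations G P R"
    if P: "subgroup P G" and f: "f \<in> subconjugations G P Q" and g: "g \<in> subconjugations G Q R"
    for P Q R f g
  proof -
    obtain a where a: "a \<in> carrier G" "\<And>x. x \<in> P \<Longrightarrow> f x = a \<otimes> x \<otimes> inv a"
      using f by (auto simp: subconjugations_def)
    obtain b where b: "b \<in> carrier G" "\<And>x. x \<in> Q \<Longrightarrow> g x = b \<otimes> x \<otimes> inv b"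
      using g by (auto simp: subconjugations_def)
    have fQ: "f x \<in> Q" if "x \<in> P" for x
      using f that by (auto simp: subconjugations_def subgroup_homs_def hom_def)
    have "compose P g f x = (b \<otimes> a) \<otimes> x \<otimes> inv (b \<otimes> a)" if x: "x \<in> P" for x
    proof -
      have "x \<in> carrier G"
        using subgroup.mem_carrier[OF P x] .
      then show ?thesis
        using x fQ[OF x] a b by (simp add: compose_eq inv_mult_group m_assoc)
    qed
    moreover have "compose P g f \<in> subgroup_homs G P R"
      using f g subgroup.m_closed[OF P]
      by (auto simp: subconjugations_def subgroup_homs_def hom_def compose_def Pi_iff)
    ultimately show ?thesis
      using a(1) b(1) unfolding subconjugations_def by blast
  qed
  have maps: "f \<in> P \<rightarrow> Q" "f \<in> extensional P" if "f \<in> subconjugations G P Q" for f P Q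
    using that by (auto simp: subconjugations_def subgroup_homs_def hom_def)
  show ?thesis
    unfolding is_category_def fusion_system_def
    using ident comp
    by (auto simp: compose_Id[OF maps] Id_compose[OF maps] intro!: compose_assoc maps)
qed

end

theory Submission
  imports Defs "HOL-Algebra.Group_Action" "HOL-Algebra.Left_Coset"
begin

text \<open>An isomorphism \<open>\<alpha> : S' \<rightarrow> R'\<close> witnessing \<open>p\<close>-local equivalence may be precomposed and
  postcomposed with conjugations without losing that property, because conjugating a conjugation
  map by an element of the group gives a conjugation map. By Sylow's second theorem the witness
  can therefore be moved to the given Sylow subgroups \<open>S\<close> and \<open>R\<close>. The ``if and only if'' in the
  definition of \<open>p\<close>-local equivalence then says that both \<open>\<alpha>\<^sub>*\<close> and \<open>(\<alpha>\<^sup>-\<^sup>1)\<^sub>*\<close> are well defined.\<close>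

section \<open>Sylow's second theorem\<close>

text \<open>Orbit lengths divide \<open>p ^ m\<close>, hence are powers of \<open>p\<close>. If
  \<open>p\<close> divided all of them it would divide \<open>card E\<close>, so some orbit has
  length \<open>p ^ 0\<close>, and its only element is fixed.\<close>

lemma (in group_action) prime_power_group_fixed_point:
  assumes "prime p" and order: "order G = p ^ m" and "finite E" and "\<not> p dvd card E"
  shows "\<exists>x \<in> E. \<forall>g \<in> carrier G. \<phi> g x = x"
proof -
  have "\<exists>c \<in> orbits G E \<phi>. \<not> p dvd card c"
    using dvd_partition[of "orbits G E \<phi>" p] orbits_coverture disjoint_union assms(3,4) by metis
  then obtain x where x: "x \<in> E" "\<not> p dvd card (orbit G \<phi> x)"
    by (auto simp: orbits_def)
  have "card (orbit G \<phi> x) dvd p ^ m"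
    using orbit_stabilizer_theorem[OF x(1)] order by (metis dvd_triv_left)
  then obtain k where "card (orbit G \<phi> x) = p ^ k"
    using \<open>prime p\<close> by (auto simp: divides_primepow_nat)
  with x(2) have "card (orbit G \<phi> x) = 1"
    by (cases k) auto
  then obtain y where y: "orbit G \<phi> x = {y}"
    by (auto simp: card_1_singleton_iff)
  then have "orbit G \<phi> x = {x}"
    using orbit_refl[OF x(1)] by auto
  then have "\<phi> g x = x" if "g \<in> carrier G" for g
    using that by (auto simp: orbit_def)
  with x(1) show ?thesis
    by blast
qed

text \<open>The action behind Sylow's second theorem: S translates the left cosets of T. The
  restriction to \<open>lcosets T\<close> is there because members of \<open>Bij (lcosets T)\<close>
  are extensional.\<close>

lemma (in group) subgroup_action_on_lcosets:
  assumes S: "subgroup S G" and T: "subgroup T G"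
  shows "group_action (G\<lparr>carrier := S\<rparr>) (lcosets T) (\<lambda>s. \<lambda>C \<in> lcosets T. s <# C)"
proof -
  have SG: "s \<in> carrier G" if "s \<in> S" for s
    using that subgroup.mem_carrier[OF S] by blast
  have sub: "C \<subseteq> carrier G" if "C \<in> lcosets T" for C
    using that subgroup.subset[OF T] l_coset_subset_G by (auto simp: LCOSETS_def)
  have closed: "s <# C \<in> lcosets T" if "s \<in> carrier G" "C \<in> lcosets T" for s C
    using that lcos_m_assoc[OF subgroup.subset[OF T]] by (auto simp: LCOSETS_def)
  have bij: "(\<lambda>C \<in> lcosets T. s <# C) \<in> Bij (lcosets T)" if s: "s \<in> carrier G" for s
  proof -
    have "bij_betw (\<lambda>C \<in> lcosets T. s <# C) (lcosets T) (lcosets T)"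
      by (rule bij_betw_byWitness[where f' = "\<lambda>C. inv s <# C"])
        (use s closed in \<open>auto simp: lcos_m_assoc[OF sub] lcos_mult_one[OF sub]\<close>)
    then show ?thesis
      by (simp add: Bij_def)
  qed
  have "(\<lambda>s. \<lambda>C \<in> lcosets T. s <# C) \<in> hom (G\<lparr>carrier := S\<rparr>) (BijGroup (lcosets T))"
  proof (rule homI)
    fix s t assume "s \<in> carrier (G\<lparr>carrier := S\<rparr>)" "t \<in> carrier (G\<lparr>carrier := S\<rparr>)"
    then have st: "s \<in> carrier G" "t \<in> carrier G"
      using SG by auto
    show "(\<lambda>C \<in> lcosets T. (s \<otimes>\<^bsub>G\<lparr>carrier := S\<rparr>\<^esub> t) <# C) =
        (\<lambda>C \<in> lcosets T. s <# C) \<otimes>\<^bsub>BijGroup (lcosets T)\<^esub> (\<lambda>C \<in> lcosets T. t <# C)"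
      using st closed by (auto simp: BijGroup_def bij compose_def lcos_m_assoc[OF sub] fun_eq_iff)
  qed (use SG bij in \<open>auto simp: BijGroup_def\<close>)
  then show ?thesis
    unfolding group_action_def group_hom_def group_hom_axioms_def
    using subgroup_imp_group[OF S] group_BijGroup by blast
qed

text \<open>The number of cosets of T is prime to \<open>p\<close>, so the \<open>p\<close>-group S
  fixes some coset xT. Then sx lies in xT for every s in S, so conjugation by \<open>inv x\<close>
  sends S into T, and equal cardinality gives equality.\<close>

lemma (in group) sylow_subgroups_conjugate:
  assumes "prime p" and fin: "finite (carrier G)"
    and "sylow_subgroup p G S" and "sylow_subgroup p G T"
  shows "\<exists>g \<in> carrier G. (\<lambda>x. g \<otimes> x \<otimes> inv g) ` S = T"
proof -
  have S: "subgroup S G" "card S = p ^ multiplicity p (order G)"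
    and T: "subgroup T G" "card T = p ^ multiplicity p (order G)"
    using assms by (auto simp: sylow_subgroup_def)
  interpret act: group_action "G\<lparr>carrier := S\<rparr>" "lcosets T" "\<lambda>s. \<lambda>C \<in> lcosets T. s <# C"
    using subgroup_action_on_lcosets S(1) T(1) .
  have index: "card (lcosets T) * p ^ multiplicity p (order G) = order G"
    using l_lagrange[OF fin T(1)] T(2) by simp
  have "order G \<noteq> 0"
    using order_gt_0_iff_finite fin by simp
  \<comment> \<open>T already accounts for the full power of \<open>p\<close> in
    \<open>order G\<close>; a factor \<open>p\<close> in the index would exceed the
    multiplicity.\<close>
  have "\<not> p dvd card (lcosets T)"
  proof
    assume "p dvd card (lcosets T)"
    then have "p * p ^ multiplicity p (order G) dvd card (lcosets T) * p ^ multiplicity p (order G)"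
      by (rule mult_dvd_mono) simp
    then have "p ^ Suc (multiplicity p (order G)) dvd order G"
      using index by simp
    then show False
      using \<open>prime p\<close> \<open>order G \<noteq> 0\<close> multiplicity_geI[of "order G" p]
      by (metis Suc_n_not_le_n not_prime_unit)
  qed
  moreover have "finite (lcosets T)"
    using fin by (simp add: LCOSETS_def)
  ultimately obtain C where C: "C \<in> lcosets T" "\<forall>s \<in> S. s <# C = C"
    using act.prime_power_group_fixed_point[OF \<open>prime p\<close>, of "multiplicity p (order G)"] S(2)
    by (auto simp: order_def)
  then obtain x where x: "x \<in> carrier G" "C = x <# T"
    by (auto simp: LCOSETS_def)
  \<comment> \<open>The conjugating element is \<open>inv x\<close>; the double inverse keeps the
    shape demanded by the conclusion.\<close>
  let ?c = "\<lambda>s. inv x \<otimes> s \<otimes> inv (inv x)"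
  have "?c s \<in> T" if s: "s \<in> S" for s
  proof -
    have sG: "s \<in> carrier G"
      using s subgroup.mem_carrier[OF S(1)] by blast
    have "x \<in> x <# T"
      using lcos_self[OF x(1) T(1)] .
    then have "s \<otimes> x \<in> s <# (x <# T)"
      unfolding l_coset_def[of G s] by blast
    then have "s \<otimes> x \<in> x <# T"
      using C(2) x(2) s by simp
    then obtain t where t: "t \<in> T" "s \<otimes> x = x \<otimes> t"
      by (auto simp: l_coset_def)
    have "?c s = inv x \<otimes> (s \<otimes> x)"
      using sG x(1) by (simp add: m_assoc)
    also have "\<dots> = t"
      using t x(1) subgroup.mem_carrier[OF T(1)] by (simp add: m_assoc[symmetric])
    finally show ?thesis
      using t(1) by simp
  qed
  then have "?c ` S \<subseteq> T"
    by blast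
  moreover have "inj_on ?c S"
    using conjugation_is_inj[of "inv x"] x(1) subgroup.mem_carrier[OF S(1)]
    by (meson inj_onI inv_closed)
  then have "card (?c ` S) = card T"
    using S(2) T(2) by (simp add: card_image)
  ultimately have "?c ` S = T"
    using finite_subset[OF subgroup.subset[OF T(1)] fin] by (simp add: card_subset_eq)
  then show ?thesis
    using x(1) by blast
qed

section \<open>Transport of subgroup homomorphisms\<close>

text \<open>Transport is studied here on arbitrary homomorphisms, before fusion enters. The data are
  symmetric in G and H, so the locale can be instantiated again at the inverse of \<alpha>.\<close>

locale subgroup_iso =
  G: group G + H: group H
  for G :: "('a, 'm) monoid_scheme" (structure) and H :: "('b, 'n) monoid_scheme" (structure) +
  fixes S :: "'a set" and R :: "'b set" and \<alpha> :: "'a \<Rightarrow> 'b"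
  assumes S: "subgroup S G" and R: "subgroup R H"
    and iso: "\<alpha> \<in> iso (G\<lparr>carrier := S\<rparr>) (H\<lparr>carrier := R\<rparr>)"
begin

lemma inj: "inj_on \<alpha> S" and image: "\<alpha> ` S = R"
  using iso by (auto simp: iso_def bij_betw_def)

lemma mult: "x \<in> S \<Longrightarrow> y \<in> S \<Longrightarrow> \<alpha> (x \<otimes>\<^bsub>G\<^esub> y) = \<alpha> x \<otimes>\<^bsub>H\<^esub> \<alpha> y"
  using iso by (auto simp: iso_def hom_def)

lemma subgroup_image:
  assumes "subgroup P G" "P \<subseteq> S"
  shows "subgroup (\<alpha> ` P) H" "\<alpha> ` P \<subseteq> R"
proof -
  interpret \<alpha>: group_hom "G\<lparr>carrier := S\<rparr>" "H\<lparr>carrier := R\<rparr>" \<alpha>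
    using iso G.subgroup_imp_group[OF S] H.subgroup_imp_group[OF R]
    by (simp add: group_hom_def group_hom_axioms_def iso_def)
  show "subgroup (\<alpha> ` P) H"
    using H.incl_subgroup[OF R] \<alpha>.subgroup_img_is_subgroup G.subgroup_incl[OF assms(1) S assms(2)]
    by blast
  show "\<alpha> ` P \<subseteq> R"
    using assms(2) image by blast
qed

text \<open>Evaluating at \<alpha> x instead of at a point y of \<alpha>(P) eliminates
  \<open>inv_into P \<alpha>\<close>, so the choice between inverting \<alpha> on P or on S
  disappears from later computations with values.\<close>

lemma transport_apply: "P \<subseteq> S \<Longrightarrow> x \<in> P \<Longrightarrow> transport_map \<alpha> P f (\<alpha> x) = \<alpha> (f x)"
  using inj_on_subset[OF inj] by (simp add: transport_map_def)

lemma transport_homs: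
  assumes P: "subgroup P G" "P \<subseteq> S" and "Q \<subseteq> S" and f: "f \<in> subgroup_homs G P Q"
  shows "transport_map \<alpha> P f \<in> subgroup_homs H (\<alpha> ` P) (\<alpha> ` Q)"
proof -
  have fQ: "f x \<in> Q" if "x \<in> P" for x
    using f that by (auto simp: subgroup_homs_def hom_def)
  have fmult: "f (x \<otimes>\<^bsub>G\<^esub> y) = f x \<otimes>\<^bsub>G\<^esub> f y" if "x \<in> P" "y \<in> P" for x y
    using f that by (auto simp: subgroup_homs_def hom_def)
  have "transport_map \<alpha> P f (\<alpha> x \<otimes>\<^bsub>H\<^esub> \<alpha> y) =
      transport_map \<alpha> P f (\<alpha> x) \<otimes>\<^bsub>H\<^esub> transport_map \<alpha> P f (\<alpha> y)" if xy: "x \<in> P" "y \<in> P" for x y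
  proof -
    have "\<alpha> x \<otimes>\<^bsub>H\<^esub> \<alpha> y = \<alpha> (x \<otimes>\<^bsub>G\<^esub> y)"
      using xy P(2) mult by (metis subsetD)
    moreover have "\<alpha> (f x \<otimes>\<^bsub>G\<^esub> f y) = \<alpha> (f x) \<otimes>\<^bsub>H\<^esub> \<alpha> (f y)"
      using fQ xy \<open>Q \<subseteq> S\<close> mult by (metis subsetD)
    ultimately show ?thesis
      using xy subgroup.m_closed[OF P(1)] by (simp add: transport_apply[OF P(2)] fmult)
  qed
  then show ?thesis
    using fQ by (auto simp: subgroup_homs_def hom_def transport_apply[OF P(2)])
      (simp add: transport_map_def)
qed

text \<open>By \<open>transport_homs\<close> the transported map is automatically a homomorphism, so
  only the conjugating element is left to find, and its condition can be read over x in P.\<close>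

lemma transport_subconjugation_iff:
  assumes "subgroup P G" "P \<subseteq> S" "Q \<subseteq> S" "f \<in> subgroup_homs G P Q"
  shows "transport_map \<alpha> P f \<in> subconjugations H (\<alpha> ` P) (\<alpha> ` Q) \<longleftrightarrow>
    (\<exists>h \<in> carrier H. \<forall>x \<in> P. \<alpha> (f x) = h \<otimes>\<^bsub>H\<^esub> \<alpha> x \<otimes>\<^bsub>H\<^esub> inv\<^bsub>H\<^esub> h)"
  using transport_homs[OF assms] by (simp add: subconjugations_def transport_apply[OF assms(2)])

lemma inverse: "subgroup_iso H G R S (inv_into S \<alpha>)"
  using S R G.group_axioms H.group_axioms group.iso_set_sym[OF G.subgroup_imp_group[OF S] iso]
  by (simp add: subgroup_iso_def subgroup_iso_axioms_def)

lemma inverse_image_image: "P \<subseteq> S \<Longrightarrow> inv_into S \<alpha> ` \<alpha> ` P = P"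
  by (rule inv_into_image_cancel[OF inj])

lemma image_inverse_image: "P \<subseteq> R \<Longrightarrow> \<alpha> ` inv_into S \<alpha> ` P = P"
  by (rule image_inv_into_cancel[OF image])

text \<open>The hypothesis that f has values in S lets \<open>inv_into S \<alpha>\<close> cancel
  \<alpha> after f; extensionality turns agreement on P into equality of functions.\<close>

lemma transport_inverse_transport:
  assumes "P \<subseteq> S" "f \<in> P \<rightarrow> S" "f \<in> extensional P"
  shows "transport_map (inv_into S \<alpha>) (\<alpha> ` P) (transport_map \<alpha> P f) = f"
proof (rule extensionalityI)
  interpret inv: subgroup_iso H G R S "inv_into S \<alpha>"
    by (rule inverse)
  show "transport_map (inv_into S \<alpha>) (\<alpha> ` P) (transport_map \<alpha> P f) \<in> extensional P"
    using inverse_image_image[OF assms(1)] by (simp add: transport_map_def)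
  show "transport_map (inv_into S \<alpha>) (\<alpha> ` P) (transport_map \<alpha> P f) x = f x" if x: "x \<in> P" for x
  proof -
    have "\<alpha> ` P \<subseteq> R"
      using assms(1) image by blast
    then have "transport_map (inv_into S \<alpha>) (\<alpha> ` P) (transport_map \<alpha> P f) (inv_into S \<alpha> (\<alpha> x)) =
        inv_into S \<alpha> (\<alpha> (f x))"
      using x assms(1) by (simp add: inv.transport_apply transport_apply)
    then show ?thesis
      using x assms inj by (simp add: subset_iff Pi_iff)
  qed
qed (rule assms(3))

text \<open>Applying the previous lemma to the inverse would produce
  \<open>inv_into R (inv_into S \<alpha>)\<close> in place of \<alpha>, and these are only sure to
  agree on S; hence a separate argument.\<close>

lemma transport_transport_inverse:
  assumes "P \<subseteq> R" "f \<in> P \<rightarrow> R" "f \<in> extensional P"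
  shows "transport_map \<alpha> (inv_into S \<alpha> ` P) (transport_map (inv_into S \<alpha>) P f) = f"
proof (rule extensionalityI)
  interpret inv: subgroup_iso H G R S "inv_into S \<alpha>"
    by (rule inverse)
  have sub: "inv_into S \<alpha> ` P \<subseteq> S"
    using assms(1) inv.image by blast
  show "transport_map \<alpha> (inv_into S \<alpha> ` P) (transport_map (inv_into S \<alpha>) P f) \<in> extensional P"
    using image_inverse_image[OF assms(1)] by (simp add: transport_map_def)
  show "transport_map \<alpha> (inv_into S \<alpha> ` P) (transport_map (inv_into S \<alpha>) P f) y = f y"
    if y: "y \<in> P" for y
  proof -
    have "transport_map \<alpha> (inv_into S \<alpha> ` P) (transport_map (inv_into S \<alpha>) P f)
        (\<alpha> (inv_into S \<alpha> y)) = \<alpha> (inv_into S \<alpha> (f y))"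
      using y by (simp add: transport_apply[OF sub] inv.transport_apply[OF assms(1)])
    then show ?thesis
      using y assms image by (simp add: f_inv_into_f subset_iff Pi_iff)
  qed
qed (rule assms(3))

end

lemma subconjugations_maps:
  assumes "f \<in> subconjugations G P Q"
  shows "f \<in> P \<rightarrow> Q" "f \<in> extensional P"
  using assms by (auto simp: subconjugations_def subgroup_homs_def hom_def)

section \<open>Fusion-preserving isomorphisms\<close>

text \<open>The condition on the witness in \<open>p_locally_equivalent\<close>, isolated for fixed
  S and R so that such witnesses can be inverted and composed.\<close>

locale fusion_preserving_iso = subgroup_iso +
  assumes preserves:
    "\<lbrakk>subgroup P G; P \<subseteq> S; subgroup Q G; Q \<subseteq> S; f \<in> subgroup_homs G P Q\<rbrakk> \<Longrightarrow>
      f \<in> subconjugations G P Q \<longleftrightarrow>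
      transport_map \<alpha> P f \<in> subconjugations H (\<alpha> ` P) (\<alpha> ` Q)"
begin

text \<open>The forward half of \<open>preserves\<close> makes transport well defined on morphisms.
  Composites are respected because the inverse of \<alpha> cancels \<alpha> between the two
  factors.\<close>

lemma transport_functor:
  "is_functor (fusion_system G S) (fusion_system H R) (\<lambda>P. \<alpha> ` P) (\<lambda>P Q f. transport_map \<alpha> P f)"
proof -
  have mor: "transport_map \<alpha> P f \<in> subconjugations H (\<alpha> ` P) (\<alpha> ` Q)"
    if "subgroup P G" "P \<subseteq> S" "subgroup Q G" "Q \<subseteq> S" "f \<in> subconjugations G P Q" for P Q f
    using that preserves[of P Q f] by (simp add: subconjugations_def)
  have ident: "transport_map \<alpha> P (\<lambda>x \<in> P. x) = (\<lambda>y \<in> \<alpha> ` P. y)" if "P \<subseteq> S" for P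
    using inj_on_subset[OF inj that] by (auto simp: transport_map_def inv_into_into f_inv_into_f fun_eq_iff)
  have comp: "transport_map \<alpha> P (compose P g f) =
      compose (\<alpha> ` P) (transport_map \<alpha> Q g) (transport_map \<alpha> P f)"
    if "P \<subseteq> S" "Q \<subseteq> S" "f \<in> subconjugations G P Q" for P Q f g
  proof (rule extensionalityI[of _ "\<alpha> ` P"])
    fix y assume "y \<in> \<alpha> ` P"
    then obtain x where x: "x \<in> P" "y = \<alpha> x"
      by blast
    then have "f x \<in> Q"
      using subconjugations_maps(1)[OF that(3)] by blast
    with x that(1,2) show "transport_map \<alpha> P (compose P g f) y =
        compose (\<alpha> ` P) (transport_map \<alpha> Q g) (transport_map \<alpha> P f) y"
      by (simp add: transport_apply compose_def)
  qed (simp_all add: transport_map_def compose_def)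
  show ?thesis
    using mor ident comp subgroup_image by (auto simp: is_functor_def fusion_system_def)
qed

text \<open>Each f between subgroups of R is the transport of its own back-transport, so
  \<open>preserves\<close> for the back-transport, read from right to left, is the required
  equivalence.\<close>

lemma inverse_fusion_preserving: "fusion_preserving_iso H G R S (inv_into S \<alpha>)"
proof -
  interpret inv: subgroup_iso H G R S "inv_into S \<alpha>"
    by (rule inverse)
  show ?thesis
  proof
    fix P Q f
    assume P: "subgroup P H" "P \<subseteq> R" and Q: "subgroup Q H" "Q \<subseteq> R"
      and f: "f \<in> subgroup_homs H P Q"
    have "transport_map \<alpha> (inv_into S \<alpha> ` P) (transport_map (inv_into S \<alpha>) P f) = f"
      using f P Q by (intro transport_transport_inverse) (auto simp: subgroup_homs_def hom_def)
    then show "f \<in> subconjugations H P Q \<longleftrightarrow> transport_map (inv_into S \<alpha>) P f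
        \<in> subconjugations G (inv_into S \<alpha> ` P) (inv_into S \<alpha> ` Q)"
      using preserves[OF inv.subgroup_image[OF P] inv.subgroup_image[OF Q]
          inv.transport_homs[OF P Q(2) f]]
      by (simp add: image_inverse_image P(2) Q(2))
  qed
qed

text \<open>\<open>transport_functor\<close> for \<alpha> and for its inverse supplies both
  functors; the two cancellation lemmas make them mutually inverse.\<close>

lemma fusion_system_iso: "fusion_system_iso G S H R \<alpha>"
proof -
  interpret inv: fusion_preserving_iso H G R S "inv_into S \<alpha>"
    by (rule inverse_fusion_preserving)
  have "transport_map (inv_into S \<alpha>) (\<alpha> ` P) (transport_map \<alpha> P f) = f"
    if "P \<subseteq> S" "Q \<subseteq> S" "f \<in> subconjugations G P Q" for P Q f
    using that subconjugations_maps[OF that(3)] by (intro transport_inverse_transport) auto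
  moreover have "transport_map \<alpha> (inv_into S \<alpha> ` P) (transport_map (inv_into S \<alpha>) P f) = f"
    if "P \<subseteq> R" "Q \<subseteq> R" "f \<in> subconjugations H P Q" for P Q f
    using that subconjugations_maps[OF that(3)] by (intro transport_transport_inverse) auto
  ultimately show ?thesis
    unfolding fusion_system_iso_def is_cat_iso_def
    by (intro conjI iso transport_functor exI[of _ "\<lambda>P. inv_into S \<alpha> ` P"]
        exI[of _ "\<lambda>P Q f. transport_map (inv_into S \<alpha>) P f"] inv.transport_functor)
      (auto simp: fusion_system_def inverse_image_image image_inverse_image)
qed

end

text \<open>The inverse functor is abstract: its \<psi> is not given as transport along the inverse
  of \<alpha>. If the transport of f is a subconjugation, \<psi> returns a subconjugation with the
  same transport, and injectivity of transport identifies it with f.\<close>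

lemma (in subgroup_iso) fusion_preserving_of_fusion_system_iso:
  assumes "fusion_system_iso G S H R \<alpha>"
  shows "fusion_preserving_iso G H S R \<alpha>"
proof
  fix P Q f
  assume P: "subgroup P G" "P \<subseteq> S" and Q: "subgroup Q G" "Q \<subseteq> S"
    and f: "f \<in> subgroup_homs G P Q"
  note images = subgroup_image[OF P] subgroup_image[OF Q]
  obtain K \<psi> where \<alpha>_functor: "is_functor (fusion_system G S) (fusion_system H R)
        (\<lambda>P. \<alpha> ` P) (\<lambda>P Q f. transport_map \<alpha> P f)"
    and \<psi>_functor: "is_functor (fusion_system H R) (fusion_system G S) K \<psi>"
    and K: "\<forall>X \<in> Obj (fusion_system G S). K (\<alpha> ` X) = X"
    and right_inverse: "\<forall>X \<in> Obj (fusion_system H R). \<forall>Y \<in> Obj (fusion_system H R).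
      \<forall>f \<in> Mor (fusion_system H R) X Y. transport_map \<alpha> (K X) (\<psi> X Y f) = f"
    using assms unfolding fusion_system_iso_def is_cat_iso_def by (elim conjE exE) (rule that)
  \<comment> \<open>This places the values of \<psi> in the morphisms from P to Q, rather than
    between unknown subgroups.\<close>
  have KPQ: "K (\<alpha> ` P) = P" "K (\<alpha> ` Q) = Q"
    using K P Q by (simp_all add: fusion_system_def)
  have \<alpha>_mor: "transport_map \<alpha> P f \<in> subconjugations H (\<alpha> ` P) (\<alpha> ` Q)"
    if "f \<in> subconjugations G P Q"
    using \<alpha>_functor that P Q by (simp add: is_functor_def fusion_system_def)
  have "\<psi> (\<alpha> ` P) (\<alpha> ` Q) h \<in> subconjugations G (K (\<alpha> ` P)) (K (\<alpha> ` Q))"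
    if "h \<in> subconjugations H (\<alpha> ` P) (\<alpha> ` Q)" for h
    using \<psi>_functor that images by (simp add: is_functor_def fusion_system_def)
  then have \<psi>_mor: "\<psi> (\<alpha> ` P) (\<alpha> ` Q) h \<in> subconjugations G P Q"
    if "h \<in> subconjugations H (\<alpha> ` P) (\<alpha> ` Q)" for h
    using that KPQ by simp
  have "transport_map \<alpha> (K (\<alpha> ` P)) (\<psi> (\<alpha> ` P) (\<alpha> ` Q) h) = h"
    if "h \<in> subconjugations H (\<alpha> ` P) (\<alpha> ` Q)" for h
    using right_inverse that images by (simp add: fusion_system_def)
  then have \<alpha>\<psi>: "transport_map \<alpha> P (\<psi> (\<alpha> ` P) (\<alpha> ` Q) h) = h"
    if "h \<in> subconjugations H (\<alpha> ` P) (\<alpha> ` Q)" for h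
    using that KPQ by simp
  have "f \<in> subconjugations G P Q"
    if t: "transport_map \<alpha> P f \<in> subconjugations H (\<alpha> ` P) (\<alpha> ` Q)"
  proof -
    \<comment> \<open>Both \<open>?f'\<close> and f are recovered by transporting the same map back
      to S, so they coincide.\<close>
    let ?f' = "\<psi> (\<alpha> ` P) (\<alpha> ` Q) (transport_map \<alpha> P f)"
    have "?f' = transport_map (inv_into S \<alpha>) (\<alpha> ` P) (transport_map \<alpha> P ?f')"
      using subconjugations_maps[OF \<psi>_mor[OF t]] P Q
      by (intro transport_inverse_transport[symmetric]) auto
    also have "\<dots> = transport_map (inv_into S \<alpha>) (\<alpha> ` P) (transport_map \<alpha> P f)"
      by (simp add: \<alpha>\<psi>[OF t])
    also have "\<dots> = f"
      using f P Q by (intro transport_inverse_transport) (auto simp: subgroup_homs_def hom_def)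
    finally show ?thesis
      using \<psi>_mor[OF t] by simp
  qed
  with \<alpha>_mor show "f \<in> subconjugations G P Q \<longleftrightarrow>
      transport_map \<alpha> P f \<in> subconjugations H (\<alpha> ` P) (\<alpha> ` Q)"
    by blast
qed

section \<open>Composites and conjugations\<close>

text \<open>Transport along \<beta> \<circ> \<alpha> is transport along \<alpha> followed by
  transport along \<beta>, so the two equivalences chain through the homomorphism in H.\<close>

lemma fusion_preserving_iso_comp:
  assumes "fusion_preserving_iso G H S R \<alpha>" and "fusion_preserving_iso H K R T \<beta>"
  shows "fusion_preserving_iso G K S T (\<beta> \<circ> \<alpha>)"
proof -
  interpret a: fusion_preserving_iso G H S R \<alpha> by fact
  interpret b: fusion_preserving_iso H K R T \<beta> by fact
  interpret ba: subgroup_iso G K S T "\<beta> \<circ> \<alpha>"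
    by (intro subgroup_iso.intro subgroup_iso_axioms.intro a.G.group_axioms b.H.group_axioms
        a.S b.R iso_set_trans[OF a.iso b.iso])
  show ?thesis
  proof
    fix P Q f
    assume P: "subgroup P G" "P \<subseteq> S" and Q: "subgroup Q G" "Q \<subseteq> S"
      and f: "f \<in> subgroup_homs G P Q"
    have "transport_map (\<beta> \<circ> \<alpha>) P f = transport_map \<beta> (\<alpha> ` P) (transport_map \<alpha> P f)"
    proof (rule extensionalityI[of _ "\<beta> ` \<alpha> ` P"])
      fix z assume "z \<in> \<beta> ` \<alpha> ` P"
      then obtain x where x: "x \<in> P" "z = \<beta> (\<alpha> x)"
        by blast
      then show "transport_map (\<beta> \<circ> \<alpha>) P f z =
          transport_map \<beta> (\<alpha> ` P) (transport_map \<alpha> P f) z"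
        using ba.transport_apply[OF P(2) x(1)]
        by (simp add: b.transport_apply[OF a.subgroup_image(2)[OF P]] a.transport_apply[OF P(2)])
    qed (simp_all add: transport_map_def image_comp)
    then show "f \<in> subconjugations G P Q \<longleftrightarrow>
        transport_map (\<beta> \<circ> \<alpha>) P f \<in> subconjugations K ((\<beta> \<circ> \<alpha>) ` P) ((\<beta> \<circ> \<alpha>) ` Q)"
      using a.preserves[OF P Q f] b.preserves[OF a.subgroup_image[OF P] a.subgroup_image[OF Q]
          a.transport_homs[OF P Q(2) f]]
      by (simp add: image_comp)
  qed
qed

text \<open>Transport along conjugation by g turns conjugation by a into conjugation by
  \<open>g \<otimes> a \<otimes> inv g\<close>, again by an element of G, and this is
  reversible.\<close>

lemma (in group) fusion_preserving_conjugation: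
  assumes S: "subgroup S G" and T: "subgroup T G" and g: "g \<in> carrier G"
    and image: "(\<lambda>x. g \<otimes> x \<otimes> inv g) ` S = T"
  shows "fusion_preserving_iso G G S T (\<lambda>x. g \<otimes> x \<otimes> inv g)"
proof -
  let ?c = "\<lambda>x. g \<otimes> x \<otimes> inv g"
  have SG: "x \<in> carrier G" if "x \<in> S" for x
    using that subgroup.mem_carrier[OF S] by blast
  \<comment> \<open>Once \<open>m_assoc\<close> has bracketed products to the right, cancellations
    occur in this form.\<close>
  have cancel: "inv g \<otimes> (g \<otimes> x) = x" if "x \<in> carrier G" for x
    using that g by (simp flip: m_assoc)
  have "inj_on ?c S"
    using conjugation_is_inj[OF g] SG by (meson inj_onI)
  moreover have "?c (x \<otimes> y) = ?c x \<otimes> ?c y" if "x \<in> carrier G" "y \<in> carrier G" for x y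
    using that g by (simp add: m_assoc cancel)
  ultimately have "?c \<in> iso (G\<lparr>carrier := S\<rparr>) (G\<lparr>carrier := T\<rparr>)"
    using image SG by (auto simp: iso_def hom_def bij_betw_def)
  then interpret subgroup_iso G G S T ?c
    by (intro subgroup_iso.intro subgroup_iso_axioms.intro group_axioms S T)
  show ?thesis
  proof
    fix P Q f
    assume P: "subgroup P G" "P \<subseteq> S" and Q: "subgroup Q G" "Q \<subseteq> S"
      and f: "f \<in> subgroup_homs G P Q"
    have PG: "x \<in> carrier G" "f x \<in> carrier G" if "x \<in> P" for x
      using that f P Q SG by (auto simp: subgroup_homs_def hom_def)
    have "(\<exists>a \<in> carrier G. \<forall>x \<in> P. f x = a \<otimes> x \<otimes> inv a) \<longleftrightarrow>
        (\<exists>h \<in> carrier G. \<forall>x \<in> P. ?c (f x) = h \<otimes> ?c x \<otimes> inv h)"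
    proof
      assume "\<exists>a \<in> carrier G. \<forall>x \<in> P. f x = a \<otimes> x \<otimes> inv a"
      then obtain a where a: "a \<in> carrier G" "\<forall>x \<in> P. f x = a \<otimes> x \<otimes> inv a"
        by blast
      have "?c (f x) = (g \<otimes> a \<otimes> inv g) \<otimes> ?c x \<otimes> inv (g \<otimes> a \<otimes> inv g)" if "x \<in> P" for x
        using a PG[OF that] that g by (simp add: m_assoc inv_mult_group cancel)
      then show "\<exists>h \<in> carrier G. \<forall>x \<in> P. ?c (f x) = h \<otimes> ?c x \<otimes> inv h"
        using a(1) g by (intro bexI[of _ "g \<otimes> a \<otimes> inv g"]) auto
    next
      assume "\<exists>h \<in> carrier G. \<forall>x \<in> P. ?c (f x) = h \<otimes> ?c x \<otimes> inv h"
      then obtain h where h: "h \<in> carrier G" "\<forall>x \<in> P. ?c (f x) = h \<otimes> ?c x \<otimes> inv h"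
        by blast
      \<comment> \<open>Solving h = g a g^-1 for a gives the witness
        \<open>inv g \<otimes> h \<otimes> g\<close>.\<close>
      have "f x = (inv g \<otimes> h \<otimes> g) \<otimes> x \<otimes> inv (inv g \<otimes> h \<otimes> g)" if "x \<in> P" for x
      proof -
        have "f x = inv g \<otimes> ?c (f x) \<otimes> g"
          using PG[OF that] g by (simp add: m_assoc cancel)
        also have "\<dots> = inv g \<otimes> (h \<otimes> ?c x \<otimes> inv h) \<otimes> g"
          using h(2) that by simp
        also have "\<dots> = (inv g \<otimes> h \<otimes> g) \<otimes> x \<otimes> inv (inv g \<otimes> h \<otimes> g)"
          using PG[OF that] g h(1) by (simp add: m_assoc inv_mult_group)
        finally show ?thesis .
      qed
      then show "\<exists>a \<in> carrier G. \<forall>x \<in> P. f x = a \<otimes> x \<otimes> inv a"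
        using h(1) g by (intro bexI[of _ "inv g \<otimes> h \<otimes> g"]) auto
    qed
    then show "f \<in> subconjugations G P Q \<longleftrightarrow>
        transport_map ?c P f \<in> subconjugations G (?c ` P) (?c ` Q)"
      unfolding transport_subconjugation_iff[OF P Q(2) f] using f by (simp add: subconjugations_def)
  qed
qed

section \<open>Change of Sylow subgroups and the equivalence\<close>

lemma (in group) sylow_subgroups_fusion_preserving_iso:
  assumes "prime p" "finite (carrier G)" "sylow_subgroup p G S" "sylow_subgroup p G T"
  shows "\<exists>\<gamma>. fusion_preserving_iso G G S T \<gamma>"
  using sylow_subgroups_conjugate[OF assms] fusion_preserving_conjugation assms(3,4)
  unfolding sylow_subgroup_def by metis

text \<open>A repackaging that makes closure under composition available for the witnesses of local
  equivalence.\<close>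

lemma p_locally_equivalent_iff:
  assumes "group G" and "group H"
  shows "p_locally_equivalent p G H \<longleftrightarrow>
    (\<exists>S R \<alpha>. sylow_subgroup p G S \<and> sylow_subgroup p H R \<and> fusion_preserving_iso G H S R \<alpha>)"
  using assms
  unfolding p_locally_equivalent_def fusion_preserving_iso_def fusion_preserving_iso_axioms_def
    subgroup_iso_def subgroup_iso_axioms_def sylow_subgroup_def
  by (intro iff_exI) blast

theorem mainTheorem2:
  fixes p :: nat
    and G :: "('a, 'm) monoid_scheme" and H :: "('b, 'n) monoid_scheme"
    and S :: "'a set" and R :: "'b set"
  assumes "prime p"
    and "group G" and "finite (carrier G)"
    and "group H" and "finite (carrier H)"
    and "sylow_subgroup p G S" and "sylow_subgroup p H R"
  shows "p_locally_equivalent p G H \<longleftrightarrow> (\<exists>\<alpha>. fusion_system_iso G S H R \<alpha>)"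
proof
  assume "p_locally_equivalent p G H"
  then obtain S' R' \<alpha> where S': "sylow_subgroup p G S'" and R': "sylow_subgroup p H R'"
    and \<alpha>: "fusion_preserving_iso G H S' R' \<alpha>"
    using p_locally_equivalent_iff assms by blast
  \<comment> \<open>\<gamma> leads from the given S to S' and \<delta> from R' to the given R, so
    the composite runs S, S', R', R.\<close>
  obtain \<gamma> where "fusion_preserving_iso G G S S' \<gamma>"
    using group.sylow_subgroups_fusion_preserving_iso assms S' by blast
  moreover obtain \<delta> where "fusion_preserving_iso H H R' R \<delta>"
    using group.sylow_subgroups_fusion_preserving_iso assms R' by blast
  ultimately have "fusion_preserving_iso G H S R (\<delta> \<circ> (\<alpha> \<circ> \<gamma>))"
    using \<alpha> by (intro fusion_preserving_iso_comp)
  then show "\<exists>\<alpha>. fusion_system_iso G S H R \<alpha>"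
    using fusion_preserving_iso.fusion_system_iso by blast
next
  assume "\<exists>\<alpha>. fusion_system_iso G S H R \<alpha>"
  then obtain \<alpha> where \<alpha>: "fusion_system_iso G S H R \<alpha>"
    by blast
  then have "subgroup_iso G H S R \<alpha>"
    using assms by (simp add: subgroup_iso_def subgroup_iso_axioms_def sylow_subgroup_def
        fusion_system_iso_def)
  then have "fusion_preserving_iso G H S R \<alpha>"
    using subgroup_iso.fusion_preserving_of_fusion_system_iso \<alpha> by blast
  \<comment> \<open>The given S and R themselves serve as the Sylow subgroups of the
    definition.\<close>
  then show "p_locally_equivalent p G H"
    using p_locally_equivalent_iff assms by blast
qed

end
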